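(* Let $p$ be an odd prime, $n\ge 1$, $q=p^n$, and let $L_{\mathbb F_q}$ be the Lorentz type algebra over the finite field $\mathbb F_q$. Then $L_{\mathbb F_q}$ is a simple Lie algebra if and only if $n$ is odd and $p$ is of the form $p=4k+3$.
   Context: For a commutative unital ring $R$, the Lorentz type algebra $L_R$ is the Lie $R$-algebra which is free as an $R$-module with basis $b_1,\dots,b_6$ and whose (alternating) bracket is given by $[b_1,b_2]=b_4$, $[b_1,b_3]=b_5$, $[b_1,b_4]=b_2$, $[b_1,b_5]=b_3$, $[b_1,b_6]=0$, $[b_2,b_3]=b_6$, $[b_2,b_4]=-b_1$, $[b_2,b_5]=0$, $[b_2,b_6]=b_3$, $[b_3,b_4]=0$, $[b_3,b_5]=-b_1$, $[b_3,b_6]=-b_2$, $[b_4,b_5]=-b_6$, $[b_4,b_6]=b_5$, $[b_5,b_6]=-b_4$. (For $R=\mathbb R$ this is $\mathfrak o(1,3)$.) *)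

theory Defs
  imports "HOL-Analysis.Analysis" "HOL-Computational_Algebra.Primes"
begin

locale lie_algebra = module scale
  for scale :: "'r::comm_ring_1 \<Rightarrow> 'l::ab_group_add \<Rightarrow> 'l" +
  fixes bracket :: "'l \<Rightarrow> 'l \<Rightarrow> 'l"
  assumes bracket_add_left: "bracket (x + y) z = bracket x z + bracket y z"
    and bracket_add_right: "bracket x (y + z) = bracket x y + bracket x z"
    and bracket_scale_left: "bracket (scale c x) y = scale c (bracket x y)"
    and bracket_scale_right: "bracket x (scale c y) = scale c (bracket x y)"
    and bracket_self: "bracket x x = 0"
    and jacobi: "bracket x (bracket y z) + bracket y (bracket z x) + bracket z (bracket x y) = 0"
begin

definition lie_ideal :: "'l set \<Rightarrow> bool"
  where "lie_ideal I \<longleftrightarrow> subspace I \<and> (\<forall>x. \<forall>y\<in>I. bracket x y \<in> I)"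

end

locale simple_lie_algebra = lie_algebra +
  assumes nonabelian: "\<exists>x y. bracket x y \<noteq> 0"
    and lie_ideal_trivial: "lie_ideal I \<Longrightarrow> I = {0} \<or> I = UNIV"

(* In the index type 6 the numerals 1, 2, 3, 4, 5, 6 are the six distinct elements (and 6 = 0). *)
definition lorentz_basis :: "6 \<Rightarrow> 'r::comm_ring_1 ^ 6"
  where "lorentz_basis i = axis i 1"

(* The alternating bilinear extension of a table of brackets [b_i, b_j] with i < j is
   the sum over i < j of (x_i y_j - x_j y_i) [b_i, b_j]; the pairs with zero bracket are
   (1,6), (2,5) and (3,4). *)
definition lorentz_bracket :: "'r::comm_ring_1 ^ 6 \<Rightarrow> 'r ^ 6 \<Rightarrow> 'r ^ 6"
  where "lorentz_bracket x y =
    (let b = lorentz_basis; m = (\<lambda>i j. x $ i * y $ j - x $ j * y $ i) in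
        m 1 2 *s b 4 + m 1 3 *s b 5 + m 1 4 *s b 2 + m 1 5 *s b 3
      + m 2 3 *s b 6 + m 2 4 *s (- b 1) + m 2 6 *s b 3
      + m 3 5 *s (- b 1) + m 3 6 *s (- b 2)
      + m 4 5 *s (- b 6) + m 4 6 *s b 5 + m 5 6 *s (- b 4))"

lemma exhaust_6:
  fixes x :: 6
  shows "x = 1 \<or> x = 2 \<or> x = 3 \<or> x = 4 \<or> x = 5 \<or> x = 6"
proof (induct x)
  case (of_int z)
  then have "z = 0 \<or> z = 1 \<or> z = 2 \<or> z = 3 \<or> z = 4 \<or> z = 5" by fastforce
  then show ?case by auto
qed

lemma forall_6: "(\<forall>i::6. P i) \<longleftrightarrow> P 1 \<and> P 2 \<and> P 3 \<and> P 4 \<and> P 5 \<and> P 6"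
  by (metis exhaust_6)

lemma lorentz_bracket_nth:
  "lorentz_bracket x y $ 1 = - (x $ 2 * y $ 4 - x $ 4 * y $ 2) - (x $ 3 * y $ 5 - x $ 5 * y $ 3)"
  "lorentz_bracket x y $ 2 = (x $ 1 * y $ 4 - x $ 4 * y $ 1) - (x $ 3 * y $ 6 - x $ 6 * y $ 3)"
  "lorentz_bracket x y $ 3 = (x $ 1 * y $ 5 - x $ 5 * y $ 1) + (x $ 2 * y $ 6 - x $ 6 * y $ 2)"
  "lorentz_bracket x y $ 4 = (x $ 1 * y $ 2 - x $ 2 * y $ 1) - (x $ 5 * y $ 6 - x $ 6 * y $ 5)"
  "lorentz_bracket x y $ 5 = (x $ 1 * y $ 3 - x $ 3 * y $ 1) + (x $ 4 * y $ 6 - x $ 6 * y $ 4)"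
  "lorentz_bracket x y $ 6 = (x $ 2 * y $ 3 - x $ 3 * y $ 2) - (x $ 4 * y $ 5 - x $ 5 * y $ 4)"
  by (simp_all add: lorentz_bracket_def lorentz_basis_def Let_def axis_def)

lemma lorentz_bracket_basis:
  fixes b :: "6 \<Rightarrow> 'r::comm_ring_1 ^ 6"
  defines "b \<equiv> lorentz_basis"
  shows "lorentz_bracket (b 1) (b 2) = b 4" "lorentz_bracket (b 1) (b 3) = b 5"
    "lorentz_bracket (b 1) (b 4) = b 2" "lorentz_bracket (b 1) (b 5) = b 3"
    "lorentz_bracket (b 1) (b 6) = 0" "lorentz_bracket (b 2) (b 3) = b 6"
    "lorentz_bracket (b 2) (b 4) = - b 1" "lorentz_bracket (b 2) (b 5) = 0"
    "lorentz_bracket (b 2) (b 6) = b 3" "lorentz_bracket (b 3) (b 4) = 0"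
    "lorentz_bracket (b 3) (b 5) = - b 1" "lorentz_bracket (b 3) (b 6) = - b 2"
    "lorentz_bracket (b 4) (b 5) = - b 6" "lorentz_bracket (b 4) (b 6) = b 5"
    "lorentz_bracket (b 5) (b 6) = - b 4"
  by (simp_all add: vec_eq_iff forall_6 lorentz_bracket_nth b_def lorentz_basis_def axis_def)

lemma lie_algebra_lorentz:
  "lie_algebra ((*s) :: 'r::comm_ring_1 \<Rightarrow> 'r ^ 6 \<Rightarrow> 'r ^ 6) lorentz_bracket"
  by unfold_locales (simp_all add: vec_eq_iff forall_6 lorentz_bracket_nth algebra_simps)

end

theory Submission
  imports Defs "HOL-Computational_Algebra.Polynomial"
begin

text \<open>
  The linear map \<open>J\<close> with \<open>J b\<^sub>1 = b\<^sub>6\<close>, \<open>J b\<^sub>2 = - b\<^sub>5\<close>, \<open>J b\<^sub>3 = b\<^sub>4\<close> and \<open>J \<circ> J = - id\<close> satisfies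
  \<open>[x, J y] = J [x, y]\<close>. If \<open>i\<^sup>2 = -1\<close> in the field, the eigenspace of \<open>J\<close> for \<open>i\<close> is a proper nonzero
  ideal. If \<open>-1\<close> is not a square, \<open>J\<close> turns the algebra into a three-dimensional algebra over
  the field \<open>F[J]\<close> in which, up to signs and powers of \<open>J\<close>, \<open>b\<^sub>1, b\<^sub>2, b\<^sub>3\<close> multiply like the cross product,
  so two or three brackets isolate a single coordinate of any element of an ideal.
  Finally, \<open>-1\<close> is a square in a finite field of odd order \<open>q\<close> iff \<open>q mod 4 = 1\<close>.
\<close>

text \<open>Multiplication by \<open>x\<close> permutes the nonzero elements, so their product may
  be cancelled from both sides.\<close>

lemma power_card_field_minus_one:
  fixes x :: "'a::{field,finite}"
  assumes "x \<noteq> 0"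
  shows "x ^ (CARD('a) - 1) = 1"
proof -
  have "bij_betw ((*) x) (UNIV - {0}) (UNIV - {0})"
    by (rule bij_betw_byWitness[where f' = "\<lambda>y. y / x"]) (use assms in auto)
  then have "(\<Prod>y\<in>UNIV - {0}. x * y) = (\<Prod>y\<in>UNIV - {0}. y)"
    by (rule prod.reindex_bij_betw)
  then show ?thesis
    by (simp add: prod.distrib card_Diff_singleton)
qed

text \<open>Translation by 1 permutes the field, so comparing sums gives
  \<open>of_nat CARD('a) = 0\<close>; were 2 zero as well, an odd cardinality would force 1 =
  0.\<close>

lemma odd_card_field_one_neq_minus_one:
  assumes "odd CARD('a::{field,finite})"
  shows "(-1 :: 'a) \<noteq> 1"
proof
  assume "(-1 :: 'a) = 1"
  then have two: "(1 :: 'a) + 1 = 0"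
    by (metis add.right_inverse)
  have "(\<Sum>x\<in>UNIV. x + 1) = (\<Sum>x\<in>UNIV. x :: 'a)"
    by (rule sum.reindex_bij_betw) (rule bij_betw_byWitness[where f' = "\<lambda>x. x - 1"], auto)
  then have "of_nat CARD('a) = (0 :: 'a)"
    by (simp add: sum.distrib)
  moreover from assms obtain k where "CARD('a) = 2 * k + 1" by (rule oddE)
  ultimately show False
    using two by (metis of_nat_1 of_nat_add of_nat_mult of_nat_numeral one_add_one mult_zero_left add_0 zero_neq_one)
qed

lemma neg_one_square_iff_card:
  assumes odd: "odd CARD('a::{field,finite})"
  shows "(\<exists>i::'a. i\<^sup>2 = -1) \<longleftrightarrow> CARD('a) mod 4 = 1"
proof
  assume "\<exists>i::'a. i\<^sup>2 = -1"
  then obtain i :: 'a where i: "i\<^sup>2 = -1" ..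
  show "CARD('a) mod 4 = 1"
  proof (rule ccontr)
    assume "CARD('a) mod 4 \<noteq> 1"
    with odd have "CARD('a) mod 4 = 3" by presburger
    define k where "k = CARD('a) div 4"
    \<comment> \<open>Half the exponent is odd, so this power of \<open>i\<close> is an odd power of
      -1.\<close>
    have k: "CARD('a) - 1 = 2 * (2 * k + 1)"
      using \<open>CARD('a) mod 4 = 3\<close> unfolding k_def by presburger
    from i have "i \<noteq> 0" by auto
    then have "1 = i ^ (CARD('a) - 1)" by (rule power_card_field_minus_one[symmetric])
    also have "\<dots> = -1" unfolding k power_mult i by simp
    finally show False using odd_card_field_one_neq_minus_one[OF odd] by simp
  qed
next
  assume "CARD('a) mod 4 = 1"
  define k where "k = CARD('a) div 4"
  have k: "CARD('a) - 1 = 4 * k"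
    using \<open>CARD('a) mod 4 = 1\<close> unfolding k_def by presburger
  have "k > 0" using finite_UNIV_card_ge_0[where 'a = 'a] k
      card_mono[of "UNIV :: 'a set" "{0, 1}"] by (cases k) auto
  \<comment> \<open>At most \<open>2 * k\<close> of the \<open>4 * k\<close> nonzero elements are
    roots of \<open>P\<close>; for any other \<open>x\<close>, the power \<open>x ^ k\<close>
    squares to -1.\<close>
  define P :: "'a poly" where "P = monom 1 (2 * k) + [:-1:]"
  have "degree P = 2 * k"
    unfolding P_def using \<open>k > 0\<close> by (subst degree_add_eq_left) (auto simp: degree_monom_eq)
  have "P \<noteq> 0" using \<open>degree P = 2 * k\<close> \<open>k > 0\<close> by auto
  then have "card {x. poly P x = 0} \<le> 2 * k"
    using card_poly_roots_bound[of P] \<open>degree P = 2 * k\<close> by simp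
  also have "\<dots> < card (UNIV - {0::'a})"
    using k \<open>k > 0\<close> by (simp add: card_Diff_singleton)
  finally have "\<not> UNIV - {0::'a} \<subseteq> {x. poly P x = 0}"
    using card_mono[of "{x. poly P x = 0}" "UNIV - {0::'a}"] by auto
  then obtain x :: 'a where x: "x \<noteq> 0" "x ^ (2 * k) \<noteq> 1"
    by (auto simp: P_def poly_monom)
  have "(x ^ (2 * k))\<^sup>2 = 1"
    using power_card_field_minus_one[OF x(1)] k by (simp flip: power_mult add: mult.commute)
  then have "x ^ (2 * k) = -1"
    using x(2) power2_eq_1_iff by blast
  then have "(x ^ k)\<^sup>2 = -1"
    by (simp add: mult.commute flip: power_mult)
  then show "\<exists>i::'a. i\<^sup>2 = -1" ..
qed

lemma simple_lorentz_imp_neg_one_nonsquare: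
  assumes "simple_lie_algebra ((*s) :: 'a::field \<Rightarrow> 'a ^ 6 \<Rightarrow> 'a ^ 6) lorentz_bracket"
  shows "i\<^sup>2 \<noteq> (-1 :: 'a)"
proof
  assume i: "i\<^sup>2 = -1"
  interpret simple_lie_algebra "(*s) :: 'a \<Rightarrow> 'a ^ 6 \<Rightarrow> 'a ^ 6" lorentz_bracket
    by (fact assms)
  have ii: "i * (i * c) = - c" for c
    using i by (simp add: power2_eq_square flip: mult.assoc)
  \<comment> \<open>\<open>I\<close> is the kernel of \<open>J - i\<close>.\<close>
  define I where "I = {x :: 'a ^ 6. x $ 1 = i * x $ 6 \<and> x $ 3 = i * x $ 4 \<and> x $ 5 = i * x $ 2}"
  have "lie_ideal I"
    unfolding lie_ideal_def vec.subspace_def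
    by (auto simp: I_def lorentz_bracket_nth algebra_simps ii)
  moreover have "(axis 1 1 :: 'a ^ 6) \<notin> I"
    by (simp add: I_def axis_def)
  \<comment> \<open>An eigenvector of \<open>J\<close> for \<open>i\<close>, as \<open>J\<close>
    sends \<open>b\<^sub>1\<close> to \<open>b\<^sub>6\<close> and \<open>b\<^sub>6\<close> to
    \<open>- b\<^sub>1\<close>.\<close>
  moreover have "(axis 6 1 + axis 1 i :: 'a ^ 6) \<in> I"
    by (simp add: I_def axis_def)
  moreover have "(axis 6 1 + axis 1 i :: 'a ^ 6) \<noteq> 0"
    by (auto simp: vec_eq_iff forall_6 axis_def)
  ultimately show False using lie_ideal_trivial by blast
qed

lemma neg_one_nonsquare_imp_simple_lorentz:
  assumes nonsquare: "\<And>i. i\<^sup>2 \<noteq> (-1 :: 'a::field)"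
  shows "simple_lie_algebra ((*s) :: 'a \<Rightarrow> 'a ^ 6 \<Rightarrow> 'a ^ 6) lorentz_bracket"
proof -
  interpret lie_algebra "(*s) :: 'a \<Rightarrow> 'a ^ 6 \<Rightarrow> 'a ^ 6" lorentz_bracket
    by (rule lie_algebra_lorentz)
  let ?b = "lorentz_basis :: 6 \<Rightarrow> 'a ^ 6"
  \<comment> \<open>This is the norm of \<open>c + d J\<close>, so nonzero elements of
    \<open>F[J]\<close> are invertible.\<close>
  have norm: "c\<^sup>2 + d\<^sup>2 \<noteq> 0" if "c \<noteq> 0 \<or> d \<noteq> 0" for c d :: 'a
  proof
    assume sum: "c\<^sup>2 + d\<^sup>2 = 0"
    with that have "d \<noteq> 0" by auto
    moreover from sum have "c\<^sup>2 = - d\<^sup>2" by (simp add: eq_neg_iff_add_eq_0)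
    ultimately have "(c / d)\<^sup>2 = -1" by (simp add: power_divide)
    with nonsquare show False by blast
  qed
  show ?thesis
  proof unfold_locales
    have "lorentz_bracket (?b 1) (?b 2) \<noteq> 0"
      by (simp add: lorentz_bracket_basis) (simp add: lorentz_basis_def)
    then show "\<exists>x y :: 'a ^ 6. lorentz_bracket x y \<noteq> 0" by blast
  next
    fix I :: "('a ^ 6) set"
    assume "lie_ideal I"
    then have sub: "vec.subspace I" and br: "y \<in> I \<Longrightarrow> lorentz_bracket x y \<in> I" for x y
      by (auto simp: lie_ideal_def)
    show "I = {0} \<or> I = UNIV"
    proof (cases "I \<subseteq> {0}")
      case True
      then show ?thesis using vec.subspace_0[OF sub] by blast
    next
      case False
      then obtain x where x: "x \<in> I" "x \<noteq> 0" by blast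
      \<comment> \<open>The hypotheses say that \<open>u = (c + d J) b\<^sub>1\<close> and \<open>J u\<close> lie in \<open>I\<close>; apply \<open>c - d J\<close> to \<open>u\<close>.\<close>
      have b1: "?b 1 \<in> I"
        if "c *s ?b 1 + d *s ?b 6 \<in> I" "c *s ?b 6 - d *s ?b 1 \<in> I" "c \<noteq> 0 \<or> d \<noteq> 0" for c d
      proof -
        have "inverse (c\<^sup>2 + d\<^sup>2) *s (c *s (c *s ?b 1 + d *s ?b 6) - d *s (c *s ?b 6 - d *s ?b 1)) \<in> I"
          by (intro vec.subspace_scale vec.subspace_diff sub that)
        also have "c *s (c *s ?b 1 + d *s ?b 6) - d *s (c *s ?b 6 - d *s ?b 1) = (c\<^sup>2 + d\<^sup>2) *s ?b 1"
          by (simp add: vec_eq_iff algebra_simps power2_eq_square)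
        finally show ?thesis
          by (simp only: vec.scale_scale left_inverse[OF norm[OF that(3)]] vec.scale_one)
      qed
      have br_neg: "- lorentz_bracket u y \<in> I" if "y \<in> I" for u y
        by (intro vec.subspace_neg sub br that)
      note eqs = vec_eq_iff forall_6 lorentz_bracket_nth lorentz_basis_def axis_def
      have "x $ 1 \<noteq> 0 \<or> x $ 6 \<noteq> 0 \<or> x $ 2 \<noteq> 0 \<or> x $ 5 \<noteq> 0 \<or> x $ 3 \<noteq> 0 \<or> x $ 4 \<noteq> 0"
        using x(2) by (auto simp: vec_eq_iff forall_6)
      \<comment> \<open>The coordinates of \<open>x\<close> over \<open>F[J]\<close> are \<open>x\<^sub>1 + x\<^sub>6 J\<close>, \<open>x\<^sub>2 - x\<^sub>5 J\<close> and \<open>x\<^sub>3 + x\<^sub>4 J\<close>.\<close>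
      then consider "x $ 1 \<noteq> 0 \<or> x $ 6 \<noteq> 0" | "x $ 2 \<noteq> 0 \<or> - x $ 5 \<noteq> 0" | "x $ 3 \<noteq> 0 \<or> x $ 4 \<noteq> 0"
        by auto
      then have "?b 1 \<in> I"
      proof cases
        case 1
        \<comment> \<open>The two inner brackets leave
          \<open>- (x\<^sub>1 + x\<^sub>6 J) b\<^sub>2\<close>, which \<open>b\<^sub>3\<close> and
          \<open>b\<^sub>4 = J b\<^sub>3\<close> carry to multiples of \<open>b\<^sub>1\<close> over
          \<open>F[J]\<close>.\<close>
        have "x $ 1 *s ?b 1 + x $ 6 *s ?b 6
            = - lorentz_bracket (?b 4) (lorentz_bracket (?b 1) (lorentz_bracket (?b 2) x))"
          "x $ 1 *s ?b 6 - x $ 6 *s ?b 1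
            = lorentz_bracket (?b 3) (lorentz_bracket (?b 1) (lorentz_bracket (?b 2) x))"
          by (simp_all add: eqs)
        then show ?thesis using 1 x(1) by (metis b1 br br_neg)
      next
        case 2
        \<comment> \<open>Bracketing with \<open>b\<^sub>1\<close> removes the first coordinate over
          \<open>F[J]\<close>; bracketing with \<open>b\<^sub>2\<close> or
          \<open>b\<^sub>5 = - J b\<^sub>2\<close> then keeps only the second.\<close>
        have "x $ 2 *s ?b 1 + (- x $ 5) *s ?b 6 = - lorentz_bracket (?b 2) (lorentz_bracket (?b 1) x)"
          "x $ 2 *s ?b 6 - (- x $ 5) *s ?b 1 = lorentz_bracket (?b 5) (lorentz_bracket (?b 1) x)"
          by (simp_all add: eqs)
        then show ?thesis using 2 x(1) by (metis b1 br br_neg)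
      next
        case 3
        have "x $ 3 *s ?b 1 + x $ 4 *s ?b 6 = - lorentz_bracket (?b 3) (lorentz_bracket (?b 1) x)"
          "x $ 3 *s ?b 6 - x $ 4 *s ?b 1 = - lorentz_bracket (?b 4) (lorentz_bracket (?b 1) x)"
          by (simp_all add: eqs)
        then show ?thesis using 3 x(1) by (metis b1 br br_neg)
      qed
      then have mem: "lorentz_bracket u (?b 1) \<in> I" "lorentz_bracket v (lorentz_bracket u (?b 1)) \<in> I" for u v
        by (auto intro: br)
      have "y \<in> I" for y
      proof -
        \<comment> \<open>Since \<open>b\<^sub>6 = J b\<^sub>1\<close>, no single bracket with
          \<open>b\<^sub>1\<close> reaches it; two are needed.\<close>
        have "y = y $ 1 *s ?b 1 + y $ 2 *s (- lorentz_bracket (?b 4) (?b 1))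
            + y $ 3 *s (- lorentz_bracket (?b 5) (?b 1)) + y $ 4 *s (- lorentz_bracket (?b 2) (?b 1))
            + y $ 5 *s (- lorentz_bracket (?b 3) (?b 1))
            + y $ 6 *s (- lorentz_bracket (?b 5) (lorentz_bracket (?b 2) (?b 1)))"
          by (simp add: eqs)
        also have "\<dots> \<in> I"
          by (intro vec.subspace_add vec.subspace_scale vec.subspace_neg sub mem \<open>?b 1 \<in> I\<close>)
        finally show ?thesis .
      qed
      then show ?thesis by blast
    qed
  qed
qed

theorem corollary3:
  fixes p n :: nat
  assumes "prime p" and "odd p" and "n \<ge> 1"
    and "CARD('a::{field,finite}) = p ^ n"
  shows "simple_lie_algebra ((*s) :: 'a \<Rightarrow> 'a ^ 6 \<Rightarrow> 'a ^ 6) lorentz_bracket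
    \<longleftrightarrow> odd n \<and> (\<exists>k. p = 4 * k + 3)"
proof -
  have "odd CARD('a)" using assms by simp
  have "simple_lie_algebra ((*s) :: 'a \<Rightarrow> 'a ^ 6 \<Rightarrow> 'a ^ 6) lorentz_bracket
      \<longleftrightarrow> \<not> (\<exists>i::'a. i\<^sup>2 = -1)"
    using neg_one_nonsquare_imp_simple_lorentz simple_lorentz_imp_neg_one_nonsquare by blast
  also have "\<dots> \<longleftrightarrow> p ^ n mod 4 \<noteq> 1"
    using neg_one_square_iff_card[OF \<open>odd CARD('a)\<close>] assms by simp
  also have "\<dots> \<longleftrightarrow> odd n \<and> p mod 4 = 3"
  proof -
    have p: "p mod 4 = 1 \<or> p mod 4 = 3" using \<open>odd p\<close> by presburger
    have "p ^ n mod 4 = (p mod 4) ^ n mod 4" by (simp add: power_mod)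
    moreover have "(3::nat) ^ n mod 4 = (if even n then 1 else 3)"
    proof (induction n)
      case (Suc n)
      have "(3::nat) ^ Suc n mod 4 = 3 * (3 ^ n mod 4) mod 4"
        by (simp add: mod_mult_right_eq)
      with Suc show ?case by simp
    qed simp
    ultimately show ?thesis using p by auto
  qed
  also have "p mod 4 = 3 \<longleftrightarrow> (\<exists>k. p = 4 * k + 3)"
    by presburger
  finally show ?thesis .
qed

end
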